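(* For $h\ge 1$ let $[h]_{p,q,x}=\sum_{j=0}^{h-2}p^{h-1-j}q^{j}+x\,q^{h-1}$ (so $[1]_{p,q,x}=x$). Then, as formal power series in $z$, \[ F_{\text{1--2, 2--1}}(p,q,x,z):=\sum_{n\ge1}\sum_{\pi\in\mathcal S_n}p^{\mathrm{non}(\pi)}q^{\mathrm{inv}(\pi)}x^{\mathrm{cyc}(\pi)}z^{n} =\sum_{n=1}^{\infty}z^{n}\prod_{i=1}^{n}[i]_{p,q,x} =\cfrac{a_1z}{1-\cfrac{a_2z}{1+a_2z-\cfrac{a_3z}{1+a_3z-\cfrac{a_4z}{1+a_4z-\cdots}}}}, \] where $a_h=[h]_{p,q,x}$.
   Context: $\mathcal S_n$ is the set of permutations of $[n]=\{1,\dots,n\}$. The standard cycle form of $\pi\in\mathcal S_n$ writes each cycle starting with its smallest element and lists the cycles in decreasing order of their smallest elements (e.g. $47613852=(275368)(14)$). $\Psi(\pi)$ is the word of length $n$ obtained by deleting the parentheses from the standard cycle form. $\mathrm{cyc}(\pi)$ is the number of cycles of $\pi$. $\mathrm{inv}(\pi)$ (cyclic inversions) is the number of pairs of positions $i<j$ with $\Psi(\pi)_i>\Psi(\pi)_j$, and $\mathrm{non}(\pi)=\binom{n}{2}-\mathrm{inv}(\pi)$. *)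

theory Defs
  imports
    "HOL-Combinatorics.Combinatorics"
    "HOL-Combinatorics.Orbits"
    "HOL-Computational_Algebra.Formal_Power_Series"
begin

hide_const (open) Perm.orbit

text \<open>A permutation of \<open>[n]\<close> is a function \<open>\<pi>\<close> with \<open>\<pi> permutes {1..n}\<close>. A fixed point
  \<open>i\<close> has \<open>orbit \<pi> i = {i}\<close>, so fixed points count as cycles of length one.\<close>

definition cycle_sets :: "nat \<Rightarrow> (nat \<Rightarrow> nat) \<Rightarrow> nat set set" where
  "cycle_sets n \<pi> = Orbits.orbit \<pi> ` {1..n}"

definition cyc :: "nat \<Rightarrow> (nat \<Rightarrow> nat) \<Rightarrow> nat" where
  "cyc n \<pi> = card (cycle_sets n \<pi>)"

text \<open>For a permutation, \<open>support \<pi> m\<close> is the list \<open>[m, \<pi> m, \<pi> (\<pi> m), \<dots>]\<close> running once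
  through the cycle of \<open>m\<close>.\<close>

definition standard_cycle_form :: "nat \<Rightarrow> (nat \<Rightarrow> nat) \<Rightarrow> nat list list" where
  "standard_cycle_form n \<pi> =
     map (support \<pi>) (rev (sorted_list_of_set (Min ` cycle_sets n \<pi>)))"

definition Psi :: "nat \<Rightarrow> (nat \<Rightarrow> nat) \<Rightarrow> nat list" where
  "Psi n \<pi> = concat (standard_cycle_form n \<pi>)"

definition cyc_inv :: "nat \<Rightarrow> (nat \<Rightarrow> nat) \<Rightarrow> nat" where
  "cyc_inv n \<pi> = card {(i, j). i < j \<and> j < n \<and> Psi n \<pi> ! i > Psi n \<pi> ! j}"

text \<open>The subtraction on \<open>nat\<close> below does not truncate: there are \<open>n choose 2\<close> pairs of
  positions \<open>i < j < n\<close>.\<close>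

definition cyc_non :: "nat \<Rightarrow> (nat \<Rightarrow> nat) \<Rightarrow> nat" where
  "cyc_non n \<pi> = (n choose 2) - cyc_inv n \<pi>"

lemma cyc_inv_le: "cyc_inv n \<pi> \<le> n choose 2"
proof -
  have "cyc_inv n \<pi> \<le> card {A. A \<subseteq> {..<n} \<and> card A = 2}"
    unfolding cyc_inv_def
  proof (rule card_inj_on_le)
    show "inj_on (\<lambda>(i, j). {i, j}) {(i, j). i < j \<and> j < n \<and> Psi n \<pi> ! i > Psi n \<pi> ! j}"
      by (auto simp: inj_on_def doubleton_eq_iff)
  qed (auto simp: card_insert_if)
  then show ?thesis
    by (simp add: n_subsets)
qed

definition qint :: "'a::comm_ring_1 \<Rightarrow> 'a \<Rightarrow> 'a \<Rightarrow> nat \<Rightarrow> 'a" where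
  "qint p q x h = (\<Sum>j<h - 1. p ^ (h - 1 - j) * q ^ j) + x * q ^ (h - 1)"

definition gen_fun :: "'a::comm_ring_1 \<Rightarrow> 'a \<Rightarrow> 'a \<Rightarrow> 'a fps" where
  "gen_fun p q x = Abs_fps (\<lambda>n. if n = 0 then 0 else
     \<Sum>\<pi> | \<pi> permutes {1..n}. p ^ cyc_non n \<pi> * q ^ cyc_inv n \<pi> * x ^ cyc n \<pi>)"

text \<open>The coefficient ring is an arbitrary commutative ring, which covers the polynomial ring
  in indeterminates \<open>p\<close>, \<open>q\<close>, \<open>x\<close>. There the library's division of power series, which needs
  inverses of coefficients, is not available; the following is the quotient of \<open>A\<close> by a power
  series \<open>B\<close> with constant term \<open>1\<close>.\<close>

definition fps_quot1 :: "'a::comm_ring_1 fps \<Rightarrow> 'a fps \<Rightarrow> 'a fps" where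
  "fps_quot1 A B = A * fps_right_inverse B 1"

lemma fps_quot1_mult: "fps_nth B 0 = 1 \<Longrightarrow> fps_quot1 A B * B = A"
  by (simp add: fps_quot1_def mult.assoc fps_right_inverse' mult.commute[of "fps_right_inverse B 1"]
      fps_right_inverse)

lemma fps_quot1_eq_divide:
  fixes A B :: "'a::field fps"
  shows "fps_nth B 0 = 1 \<Longrightarrow> fps_quot1 A B = A / B"
  by (simp add: fps_quot1_def fps_divide_unit fps_inverse_def)

text \<open>\<open>cf_tail a h d\<close> is the tail
  \<open>a\<^sub>h z / (1 + a\<^sub>h z - a\<^sub>h\<^sub>+\<^sub>1 z / (1 + a\<^sub>h\<^sub>+\<^sub>1 z - \<dots>))\<close> of the continued fraction, cut off (with \<open>0\<close> in
  place of what remains) after \<open>d\<close> levels. The infinite continued fraction is the limit of its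
  truncations \<open>cf_trunc a d\<close> in the topology of formal power series.\<close>

primrec cf_tail :: "(nat \<Rightarrow> 'a::comm_ring_1) \<Rightarrow> nat \<Rightarrow> nat \<Rightarrow> 'a fps" where
  "cf_tail a h 0 = 0"
| "cf_tail a h (Suc d) =
     fps_quot1 (fps_const (a h) * fps_X) (1 + fps_const (a h) * fps_X - cf_tail a (Suc h) d)"

definition cf_trunc :: "(nat \<Rightarrow> 'a::comm_ring_1) \<Rightarrow> nat \<Rightarrow> 'a fps" where
  "cf_trunc a d = fps_quot1 (fps_const (a 1) * fps_X) (1 - cf_tail a 2 d)"

lemma cf_tail_nth_0 [simp]: "fps_nth (cf_tail a h d) 0 = 0"
  by (cases d) (simp_all add: fps_quot1_def)

end

theory Submission
  imports Defs
begin

text \<open>Every permutation of \<open>[n + 1]\<close> arises from exactly one permutation of \<open>[n]\<close> by making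
  \<open>n + 1\<close> a fixed point or inserting it into a cycle right after some \<open>b \<in> [n]\<close>. On the word
  \<open>\<Psi>\<close> this puts \<open>n + 1\<close> in front, or right after the letter \<open>b\<close>; with \<open>k\<close> letters to its
  left it creates \<open>n - k\<close> inversions and \<open>k\<close> non-inversions, and a new cycle appears only if
  \<open>k = 0\<close>. Hence the coefficient of \<open>z\<^sup>n\<^sup>+\<^sup>1\<close> is \<open>[n + 1]\<^sub>p\<^sub>,\<^sub>q\<^sub>,\<^sub>x\<close> times that of \<open>z\<^sup>n\<close>.

  If \<open>T\<^sub>h\<close> denotes the tail of the continued fraction, then
  \<open>1 / (1 - T\<^sub>h) = 1 + a\<^sub>h z / (1 - T\<^sub>h\<^sub>+\<^sub>1)\<close>, which also holds for the truncated tails. So the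
  truncated continued fraction is a partial sum of the series.\<close>

section \<open>Standard cycle forms\<close>

text \<open>The equation \<open>map \<pi> xs = rotate1 xs\<close> says that \<open>\<pi>\<close>
  sends each entry to the cyclically next one. Phrased on lists, the form can be checked after an
  insertion without computing orbits.\<close>

definition is_cycle_form :: "nat \<Rightarrow> (nat \<Rightarrow> nat) \<Rightarrow> nat list list \<Rightarrow> bool" where
  "is_cycle_form n \<pi> xss \<longleftrightarrow>
     distinct (concat xss) \<and> set (concat xss) = {1..n} \<and> sorted_wrt (>) (map hd xss) \<and>
     (\<forall>xs\<in>set xss. xs \<noteq> [] \<and> (\<forall>y\<in>set xs. hd xs \<le> y) \<and> map \<pi> xs = rotate1 xs)"

section \<open>Cycles as lists that the permutation rotates\<close>

lemma funpow_nth_of_rotate1: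
  assumes "map f xs = rotate1 xs" "i < length xs"
  shows "(f ^^ k) (xs ! i) = xs ! ((i + k) mod length xs)"
proof (induction k)
  case 0
  then show ?case using assms by simp
next
  case (Suc k)
  let ?m = "(i + k) mod length xs"
  have m: "?m < length xs" using assms(2) by (intro mod_less_divisor) auto
  have "f (xs ! ?m) = rotate1 xs ! ?m"
    using m by (simp flip: assms(1))
  also have "\<dots> = xs ! (Suc ?m mod length xs)"
    using m by (rule nth_rotate1)
  finally show ?case using Suc by (simp add: mod_Suc_eq)
qed

lemma orbit_of_rotate1:
  assumes "map f xs = rotate1 xs" "y \<in> set xs"
  shows "Orbits.orbit f y = set xs"
proof -
  obtain i where i: "i < length xs" "y = xs ! i"
    using assms(2) by (auto simp: in_set_conv_nth)
  let ?l = "length xs"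
  have "Orbits.orbit f y = {xs ! ((i + k) mod ?l) | k. 0 < k}"
    by (simp add: orbit_altdef funpow_nth_of_rotate1[OF assms(1) i(1)] i(2))
  also have "\<dots> = set xs"
  proof (intro subset_antisym subsetI)
    fix z assume "z \<in> {xs ! ((i + k) mod ?l) | k. 0 < k}"
    then show "z \<in> set xs" using i(1) by (auto intro!: nth_mem mod_less_divisor)
  next
    fix z assume "z \<in> set xs"
    then obtain j where j: "j < ?l" "z = xs ! j" by (auto simp: in_set_conv_nth)
    \<comment> \<open>So many steps lead from position \<open>i\<close> past the end of the list to
      position \<open>j\<close>; the number is positive, as the orbit requires, because
      \<open>i < ?l\<close>.\<close>
    have "(i + (?l - i + j)) mod ?l = j" "0 < ?l - i + j"
      using i(1) j(1) by auto
    then show "z \<in> {xs ! ((i + k) mod ?l) | k. 0 < k}"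
      using j(2) by (intro CollectI exI[of _ "?l - i + j"]) simp
  qed
  finally show ?thesis .
qed

lemma support_of_rotate1:
  assumes "map f xs = rotate1 xs" "distinct xs" "xs \<noteq> []"
  shows "support f (hd xs) = xs"
proof -
  let ?l = "length xs"
  have pow: "(f ^^ k) (hd xs) = xs ! (k mod ?l)" for k
    using funpow_nth_of_rotate1[OF assms(1), of 0 k] assms(3) by (simp add: hd_conv_nth)
  have "least_power f (hd xs) = ?l"
    unfolding least_power_def
  proof (rule Least_equality)
    show "(f ^^ ?l) (hd xs) = hd xs \<and> 0 < ?l"
      using assms(3) pow[of ?l] by (simp add: hd_conv_nth)
  next
    fix k assume k: "(f ^^ k) (hd xs) = hd xs \<and> 0 < k"
    from k have "xs ! (k mod ?l) = xs ! 0"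
      using assms(3) pow[of k] by (simp add: hd_conv_nth)
    \<comment> \<open>As the entries are distinct, the head recurs only after full turns.\<close>
    then have "k mod ?l = 0" using assms(2,3) by (simp add: nth_eq_iff_index_eq)
    then show "?l \<le> k" using k by (auto simp: mod_eq_0_iff_dvd dest: dvd_imp_le)
  qed
  then have "support f (hd xs) = map (\<lambda>i. xs ! (i mod ?l)) [0..<?l]" by (simp add: pow)
  also have "\<dots> = map ((!) xs) [0..<?l]" by (rule map_cong) auto
  finally show ?thesis by (simp add: map_nth)
qed

lemma cycle_sets_of_is_cycle_form:
  assumes "is_cycle_form n \<pi> xss"
  shows "cycle_sets n \<pi> = set ` set xss"
proof -
  have "cycle_sets n \<pi> = (\<Union>xs\<in>set xss. Orbits.orbit \<pi> ` set xs)"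
    using assms unfolding is_cycle_form_def cycle_sets_def by (metis image_UN set_concat)
  also have "\<dots> = (\<Union>xs\<in>set xss. {set xs})"
  proof (rule SUP_cong[OF refl])
    fix xs assume "xs \<in> set xss"
    then have "map \<pi> xs = rotate1 xs" "xs \<noteq> []"
      using assms by (auto simp: is_cycle_form_def)
    then show "Orbits.orbit \<pi> ` set xs = {set xs}"
      using orbit_of_rotate1[of \<pi> xs] by (auto simp: image_iff) (metis list.set_sel(1))+
  qed
  finally show ?thesis by auto
qed

text \<open>The heads are the cycle minima in decreasing order, so the reversed sorted list of
  minima is the list of heads, and \<open>support\<close> rebuilds each list from its head.\<close>

lemma
  assumes "is_cycle_form n \<pi> xss"
  shows standard_cycle_form_eqI: "standard_cycle_form n \<pi> = xss"
    and cyc_eqI: "cyc n \<pi> = length xss"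
proof -
  have form: "sorted_wrt (>) (map hd xss)"
    "\<And>xs. xs \<in> set xss \<Longrightarrow> xs \<noteq> [] \<and> (\<forall>y\<in>set xs. hd xs \<le> y) \<and> map \<pi> xs = rotate1 xs"
    using assms by (auto simp: is_cycle_form_def)
  have Min: "Min (set xs) = hd xs" if "xs \<in> set xss" for xs
    using form(2)[OF that] by (intro Min_eqI) auto
  have heads: "Min ` cycle_sets n \<pi> = set (map hd xss)"
    by (simp add: cycle_sets_of_is_cycle_form[OF assms] image_image Min cong: image_cong)
  have "sorted_wrt (<) (rev (map hd xss))"
    using form(1) by (simp add: sorted_wrt_rev)
  then have "sorted_list_of_set (set (rev (map hd xss))) = rev (map hd xss)"
    by (intro sorted_list_of_set.idem_if_sorted_distinct) (auto simp: strict_sorted_iff)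
  then have "standard_cycle_form n \<pi> = map (support \<pi>) (map hd xss)"
    by (simp add: standard_cycle_form_def heads rev_map)
  also have "\<dots> = map id xss"
    unfolding map_map
  proof (rule map_cong[OF refl])
    fix xs assume "xs \<in> set xss"
    moreover from this have "distinct xs"
      using assms by (auto simp: is_cycle_form_def distinct_concat_iff)
    ultimately show "(support \<pi> \<circ> hd) xs = id xs"
      using form(2)[of xs] support_of_rotate1[of \<pi> xs] by simp
  qed
  finally show "standard_cycle_form n \<pi> = xss" by simp
  have distinct_hd: "distinct (map hd xss)"
    using form(1) by (metis distinct_rev sorted_wrt_rev strict_sorted_iff)
  \<comment> \<open>The entry set determines the list: its minimum is the head, and no two lists
    share a head.\<close>
  have "inj_on set (set xss)"
    by (rule inj_onI) (metis Min distinct_hd distinct_map inj_onD)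
  then show "cyc n \<pi> = length xss"
    using distinct_hd
    by (simp add: cyc_def cycle_sets_of_is_cycle_form[OF assms] card_image distinct_card distinct_map)
qed

section \<open>Inserting the new maximum into a cycle form\<close>

lemma is_cycle_form_fixed_point:
  assumes "is_cycle_form n \<pi> xss" "\<pi> (Suc n) = Suc n"
  shows "is_cycle_form (Suc n) \<pi> ([Suc n] # xss)"
proof -
  have "hd xs < Suc n" if "xs \<in> set xss" for xs
  proof -
    have "hd xs \<in> set xs" "set xs \<subseteq> set (concat xss)"
      using that assms(1) by (auto simp: is_cycle_form_def)
    moreover have "set (concat xss) = {1..n}"
      using assms(1) by (simp add: is_cycle_form_def)
    ultimately have "hd xs \<in> {1..n}" by blast
    then show ?thesis by simp
  qed
  then show ?thesis
    using assms unfolding is_cycle_form_def by (auto simp: atLeastAtMostSuc_conv)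
qed

text \<open>Since \<open>\<pi>\<close> fixes \<open>Suc n\<close>, the composition sends
  \<open>b\<close> to \<open>Suc n\<close> and \<open>Suc n\<close> to \<open>\<pi> b\<close>. This
  splices \<open>Suc n\<close> into the list of \<open>b\<close>, right after \<open>b\<close>, and
  changes no head.\<close>

lemma is_cycle_form_insert:
  assumes form: "is_cycle_form n \<pi> xss" and fixed: "\<pi> (Suc n) = Suc n"
    and split: "concat xss = us @ b # vs"
  obtains xss' where "is_cycle_form (Suc n) (\<pi> \<circ> transpose (Suc n) b) xss'"
    "concat xss' = us @ b # Suc n # vs" "length xss' = length xss"
proof -
  let ?N = "Suc n" and ?\<pi> = "\<pi> \<circ> transpose (Suc n) b"
  have dist: "distinct (concat xss)" and set: "set (concat xss) = {1..n}"
    using form by (auto simp: is_cycle_form_def)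
  have "b \<in> set (concat xss)" by (simp add: split)
  then obtain ys where "ys \<in> set xss" "b \<in> set ys" by auto
  then obtain yss zss as bs where xss: "xss = yss @ (as @ b # bs) # zss"
    by (metis split_list)
  \<comment> \<open>The letters are distinct, so the word splits at \<open>b\<close> in only one
    way.\<close>
  have us: "us = concat yss @ as" and vs: "vs = bs @ concat zss"
  proof -
    have eq: "(concat yss @ as) @ b # (bs @ concat zss) = us @ b # vs"
      using split by (simp add: xss)
    have "b \<notin> set (concat yss @ as)" "b \<notin> set (bs @ concat zss)"
      using dist by (auto simp: xss)
    then show "us = concat yss @ as" "vs = bs @ concat zss"
      using append_Cons_eq_iff[of b "concat yss @ as" "bs @ concat zss" us vs] eq by auto
  qed
  define xss' where "xss' = yss @ (as @ b # ?N # bs) # zss"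
  have other: "map ?\<pi> xs = map \<pi> xs" if "b \<notin> set xs" "set xs \<subseteq> {1..n}" for xs
    using that by (auto simp: transpose_def)
  have fresh: "set as \<subseteq> {1..n}" "set bs \<subseteq> {1..n}" "b \<in> {1..n}" "b \<notin> set as" "b \<notin> set bs"
    using dist set by (auto simp: xss)
  have old: "xs \<noteq> [] \<and> (\<forall>y\<in>set xs. hd xs \<le> y) \<and> map ?\<pi> xs = rotate1 xs"
    if "xs \<in> set yss \<union> set zss" for xs
  proof -
    have "b \<notin> set xs" "set xs \<subseteq> {1..n}"
      using that dist set by (auto simp: xss)
    then have "map ?\<pi> xs = map \<pi> xs" by (rule other)
    moreover have "xs \<in> set xss" using that by (auto simp: xss)
    ultimately show ?thesis
      using form by (simp add: is_cycle_form_def del: map_eq_conv)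
  qed
  have cyc_old: "map \<pi> (as @ b # bs) = rotate1 (as @ b # bs)"
    and hd_old: "\<forall>y\<in>set (as @ b # bs). hd (as @ b # bs) \<le> y"
    using form by (auto simp: is_cycle_form_def xss)
  have hd: "hd (as @ b # ?N # bs) = hd (as @ b # bs)"
    by (cases as) auto
  have "hd (as @ b # bs) \<le> ?N"
    using fresh hd_old by (cases as) auto
  then have new_le: "\<forall>y\<in>set (as @ b # ?N # bs). hd (as @ b # ?N # bs) \<le> y"
    using hd_old unfolding hd by auto
  have new: "map ?\<pi> (as @ b # ?N # bs) = rotate1 (as @ b # ?N # bs)"
  proof -
    have "map ?\<pi> (as @ b # ?N # bs) = map \<pi> as @ ?N # \<pi> b # map \<pi> bs"
      using other[of as] other[of bs] fresh fixed by simp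
    also have "\<dots> = rotate1 (as @ b # ?N # bs)"
    proof (cases as)
      case Nil
      then show ?thesis using cyc_old by simp
    next
      case (Cons a as')
      have "map \<pi> as @ \<pi> b # map \<pi> bs = (as' @ [b]) @ (bs @ [a])"
        using cyc_old by (simp add: Cons)
      \<comment> \<open>Both sides are cut after \<open>length as\<close> entries, since
        \<open>as' @ [b]\<close> loses \<open>a\<close> and gains \<open>b\<close>. The letter
        \<open>?N\<close> goes into this cut.\<close>
      then have "map \<pi> as = as' @ [b] \<and> \<pi> b # map \<pi> bs = bs @ [a]"
        by (subst (asm) append_eq_append_conv) (simp_all add: Cons)
      then show ?thesis by (simp add: Cons)
    qed
    finally show ?thesis .
  qed
  have "is_cycle_form ?N ?\<pi> xss'"
    unfolding is_cycle_form_def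
  proof (intro conjI ballI)
    have "?N \<notin> set (concat xss)" by (simp only: set) simp
    then show "distinct (concat xss')"
      using dist by (auto simp: xss'_def xss)
    have "set (concat xss') = insert ?N (set (concat xss))"
      by (auto simp: xss'_def xss)
    then show "set (concat xss') = {1..?N}"
      unfolding set by auto
    have "map hd xss' = map hd xss" by (simp add: xss xss'_def hd)
    then show "sorted_wrt (>) (map hd xss')"
      using form by (simp only: is_cycle_form_def)
  next
    fix xs assume "xs \<in> set xss'"
    then have "xs = as @ b # ?N # bs \<or> xs \<in> set yss \<union> set zss"
      by (auto simp: xss'_def)
    then show "xs \<noteq> []" "map ?\<pi> xs = rotate1 xs"
      and "\<And>y. y \<in> set xs \<Longrightarrow> hd xs \<le> y"
      using old new new_le by blast+
  qed
  moreover have "concat xss' = us @ b # ?N # vs"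
    by (simp add: xss'_def us vs)
  moreover have "length xss' = length xss"
    by (simp add: xss'_def xss)
  ultimately show thesis by (rule that)
qed

text \<open>\<open>permutes_insert\<close> composes with the transposition on the left; to get it on
  the right, it is applied to \<open>inv \<pi>\<close>. The choice \<open>b = Suc n\<close> gives
  the identity transposition, hence the first case.\<close>

lemma permutes_Suc_cases:
  assumes "\<pi> permutes {1..Suc n}"
  obtains \<sigma> where "\<sigma> permutes {1..n}" "\<pi> = \<sigma>"
  | \<sigma> b where "\<sigma> permutes {1..n}" "b \<in> {1..n}" "\<pi> = \<sigma> \<circ> transpose (Suc n) b"
proof -
  have "inv \<pi> permutes insert (Suc n) {1..n}"
    using permutes_inv[OF assms] by (simp add: atLeastAtMostSuc_conv)
  then have "inv \<pi> \<in> (\<lambda>(b, q). transpose (Suc n) b \<circ> q) `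
      {(b, q). b \<in> insert (Suc n) {1..n} \<and> q \<in> {q. q permutes {1..n}}}"
    by (subst permutes_insert[symmetric]) simp
  then obtain b q where b: "b \<in> insert (Suc n) {1..n}" and q: "q permutes {1..n}"
    and inv: "inv \<pi> = transpose (Suc n) b \<circ> q"
    by (elim imageE) (auto intro: that)
  have "\<pi> = inv (inv \<pi>)"
    using assms by (simp add: permutes_inv_inv)
  also have "\<dots> = inv q \<circ> transpose (Suc n) b"
    unfolding inv using permutes_bij[OF q] by (simp add: o_inv_distrib)
  finally have eq: "\<pi> = inv q \<circ> transpose (Suc n) b" .
  show thesis
    using that(1)[of "inv q"] that(2)[of "inv q" b] b eq permutes_inv[OF q] by auto
qed

text \<open>The two insertions build a form by induction; \<open>standard_cycle_form_eqI\<close>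
  then identifies it as the standard one.\<close>

lemma ex_is_cycle_form: "\<pi> permutes {1..n} \<Longrightarrow> \<exists>xss. is_cycle_form n \<pi> xss"
proof (induction n arbitrary: \<pi>)
  case 0
  then show ?case by (intro exI[of _ "[]"]) (simp add: is_cycle_form_def)
next
  case (Suc n)
  from Suc.prems show ?case
  proof (cases rule: permutes_Suc_cases)
    case (1 \<sigma>)
    with Suc.IH obtain xss where "is_cycle_form n \<sigma> xss" by blast
    moreover have "\<sigma> (Suc n) = Suc n" using 1 by (simp add: permutes_def)
    ultimately show ?thesis using 1 is_cycle_form_fixed_point by blast
  next
    case (2 \<sigma> b)
    with Suc.IH obtain xss where xss: "is_cycle_form n \<sigma> xss" by blast
    moreover have "\<sigma> (Suc n) = Suc n" using 2 by (simp add: permutes_def)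
    moreover have "b \<in> set (concat xss)" using xss 2 by (simp add: is_cycle_form_def)
    then obtain us vs where "concat xss = us @ b # vs" by (meson split_list)
    ultimately show ?thesis using 2(3) is_cycle_form_insert by metis
  qed
qed

lemma is_cycle_form_standard_cycle_form:
  "\<pi> permutes {1..n} \<Longrightarrow> is_cycle_form n \<pi> (standard_cycle_form n \<pi>)"
  using ex_is_cycle_form standard_cycle_form_eqI by metis

section \<open>The word \<open>Psi\<close> and its change under insertion\<close>

lemma
  assumes "\<pi> permutes {1..n}"
  shows distinct_Psi: "distinct (Psi n \<pi>)"
    and set_Psi: "set (Psi n \<pi>) = {1..n}"
    and length_Psi: "length (Psi n \<pi>) = n"
proof -
  show "distinct (Psi n \<pi>)" "set (Psi n \<pi>) = {1..n}"
    using is_cycle_form_standard_cycle_form[OF assms] by (auto simp: is_cycle_form_def Psi_def)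
  then show "length (Psi n \<pi>) = n"
    by (metis card_atLeastAtMost diff_Suc_1 distinct_card)
qed

lemma
  assumes "\<pi> permutes {1..n}"
  shows Psi_fixed_point: "Psi (Suc n) \<pi> = Suc n # Psi n \<pi>"
    and cyc_fixed_point: "cyc (Suc n) \<pi> = Suc (cyc n \<pi>)"
proof -
  note form = is_cycle_form_standard_cycle_form[OF assms]
  have "\<pi> (Suc n) = Suc n" using assms by (simp add: permutes_def)
  note form' = is_cycle_form_fixed_point[OF form this]
  show "Psi (Suc n) \<pi> = Suc n # Psi n \<pi>"
    using standard_cycle_form_eqI[OF form'] by (simp add: Psi_def)
  show "cyc (Suc n) \<pi> = Suc (cyc n \<pi>)"
    using cyc_eqI[OF form] cyc_eqI[OF form'] by simp
qed

lemma
  assumes "\<pi> permutes {1..n}" "Psi n \<pi> = us @ b # vs"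
  shows Psi_insert: "Psi (Suc n) (\<pi> \<circ> transpose (Suc n) b) = us @ b # Suc n # vs"
    and cyc_insert: "cyc (Suc n) (\<pi> \<circ> transpose (Suc n) b) = cyc n \<pi>"
proof -
  note form = is_cycle_form_standard_cycle_form[OF assms(1)]
  have "\<pi> (Suc n) = Suc n" using assms(1) by (simp add: permutes_def)
  with form obtain xss' where xss': "is_cycle_form (Suc n) (\<pi> \<circ> transpose (Suc n) b) xss'"
    "concat xss' = us @ b # Suc n # vs" "length xss' = length (standard_cycle_form n \<pi>)"
    by (rule is_cycle_form_insert[OF _ _ assms(2)[unfolded Psi_def]])
  show "Psi (Suc n) (\<pi> \<circ> transpose (Suc n) b) = us @ b # Suc n # vs"
    using standard_cycle_form_eqI[OF xss'(1)] xss'(2) by (simp add: Psi_def)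
  show "cyc (Suc n) (\<pi> \<circ> transpose (Suc n) b) = cyc n \<pi>"
    using cyc_eqI[OF form] cyc_eqI[OF xss'(1)] xss'(3) by simp
qed

section \<open>Inversions\<close>

primrec inversions :: "nat list \<Rightarrow> nat" where
  "inversions [] = 0"
| "inversions (x # xs) = length (filter (\<lambda>y. y < x) xs) + inversions xs"

lemma card_inversions:
  "card {(i, j). i < j \<and> j < length xs \<and> xs ! i > xs ! j} = inversions xs"
proof (induction xs)
  case (Cons x xs)
  let ?I = "\<lambda>xs. {(i, j). i < j \<and> j < length xs \<and> xs ! i > (xs ! j :: nat)}"
  let ?J = "{j. j < length xs \<and> xs ! j < x}"
  \<comment> \<open>The pairs are separated by whether the left position is 0; the others are
    shifted pairs of \<open>xs\<close>.\<close>
  have split: "?I (x # xs) = (\<lambda>j. (0, Suc j)) ` ?J \<union> map_prod Suc Suc ` ?I xs"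
  proof (intro set_eqI iffI)
    fix z assume "z \<in> ?I (x # xs)"
    then obtain i j where z: "z = (i, Suc j)" "i \<le> j" "j < length xs" "(x # xs) ! i > xs ! j"
      by (cases z; cases "snd z") auto
    then show "z \<in> (\<lambda>j. (0, Suc j)) ` ?J \<union> map_prod Suc Suc ` ?I xs"
      by (cases i) (auto simp: image_iff)
  qed auto
  have fin: "finite (?I xs)"
    by (rule finite_subset[of _ "{..<length xs} \<times> {..<length xs}"]) auto
  have "card (?I (x # xs)) = card ?J + card (?I xs)"
    unfolding split using fin
    by (subst card_Un_disjoint) (auto simp: card_image inj_on_def)
  also have "card ?J = length (filter (\<lambda>y. y < x) xs)"
    by (simp add: length_filter_conv_card)
  finally show ?case using Cons.IH by simp
qed simp

text \<open>The maximum forms an inversion with every letter to its right and with none to its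
  left.\<close>

lemma inversions_insert_max:
  assumes "\<forall>y\<in>set (us @ vs). y < m"
  shows "inversions (us @ m # vs) = inversions (us @ vs) + length vs"
  using assms by (induction us) auto

lemma cyc_inv_eq_inversions: "\<pi> permutes {1..n} \<Longrightarrow> cyc_inv n \<pi> = inversions (Psi n \<pi>)"
  using card_inversions[of "Psi n \<pi>"] by (simp add: cyc_inv_def length_Psi)

section \<open>The recurrence for the coefficients\<close>

definition weight :: "'a::comm_ring_1 \<Rightarrow> 'a \<Rightarrow> 'a \<Rightarrow> nat \<Rightarrow> (nat \<Rightarrow> nat) \<Rightarrow> 'a" where
  "weight p q x n \<pi> = p ^ cyc_non n \<pi> * q ^ cyc_inv n \<pi> * x ^ cyc n \<pi>"

text \<open>There are \<open>n\<close> new pairs of positions, so \<open>l\<close> new inversions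
  leave \<open>k\<close> new non-inversions; \<open>cyc_inv_le\<close> excludes truncated
  subtraction.\<close>

lemma cyc_non_Suc:
  assumes "cyc_inv (Suc n) \<pi>' = cyc_inv n \<pi> + l" "k + l = n"
  shows "cyc_non (Suc n) \<pi>' = cyc_non n \<pi> + k"
proof -
  have "Suc n choose 2 = (n choose 2) + n"
    by (simp add: numeral_2_eq_2)
  then show ?thesis
    using cyc_inv_le[of n \<pi>] assms by (simp add: cyc_non_def)
qed

lemma weight_fixed_point:
  assumes "\<pi> permutes {1..n}"
  shows "weight p q x (Suc n) \<pi> = weight p q x n \<pi> * (x * q ^ n)"
proof -
  have perm: "\<pi> permutes {1..Suc n}" by (rule permutes_subset[OF assms]) auto
  have "\<forall>y\<in>set ([] @ Psi n \<pi>). y < Suc n" by (simp add: set_Psi[OF assms])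
  from inversions_insert_max[OF this]
  have inv: "cyc_inv (Suc n) \<pi> = cyc_inv n \<pi> + n"
    using assms perm by (simp add: cyc_inv_eq_inversions Psi_fixed_point length_Psi)
  have "cyc_non (Suc n) \<pi> = cyc_non n \<pi>"
    using cyc_non_Suc[OF inv, of 0] by simp
  then show ?thesis
    by (simp add: weight_def inv cyc_fixed_point[OF assms] power_add algebra_simps)
qed

text \<open>Positions count from 0, so after position \<open>k\<close> the new letter has
  \<open>Suc k\<close> letters to its left and \<open>n - Suc k\<close> to its right.\<close>

lemma weight_insert:
  assumes "\<pi> permutes {1..n}" "k < n"
  shows "weight p q x (Suc n) (\<pi> \<circ> transpose (Suc n) (Psi n \<pi> ! k)) =
    weight p q x n \<pi> * (p ^ Suc k * q ^ (n - Suc k))"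
proof -
  let ?w = "Psi n \<pi>"
  let ?b = "?w ! k" and ?us = "take k ?w" and ?vs = "drop (Suc k) ?w"
  let ?\<pi> = "\<pi> \<circ> transpose (Suc n) ?b"
  have len: "length ?w = n" by (rule length_Psi[OF assms(1)])
  have w: "?w = ?us @ ?b # ?vs"
    using assms(2) len by (simp add: id_take_nth_drop)
  have "?b \<in> {1..n}"
    using assms len nth_mem[of k ?w] by (simp add: set_Psi)
  then have perm: "?\<pi> permutes {1..Suc n}"
    by (intro permutes_compose permutes_swap_id permutes_subset[OF assms(1)]) auto
  \<comment> \<open>Here \<open>?b\<close> belongs to the prefix, because \<open>Suc n\<close> is
    placed after it.\<close>
  have "\<forall>y\<in>set ((?us @ [?b]) @ ?vs). y < Suc n"
    using w set_Psi[OF assms(1)] by auto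
  from inversions_insert_max[OF this]
  have inv: "cyc_inv (Suc n) ?\<pi> = cyc_inv n \<pi> + (n - Suc k)"
    using w len
    by (simp add: cyc_inv_eq_inversions[OF perm] cyc_inv_eq_inversions[OF assms(1)]
        Psi_insert[OF assms(1) w])
  have non: "cyc_non (Suc n) ?\<pi> = cyc_non n \<pi> + Suc k"
    using cyc_non_Suc[OF inv, of "Suc k"] assms(2) by simp
  show ?thesis
    unfolding weight_def inv non cyc_insert[OF assms(1) w] power_add by (simp only: mult_ac)
qed

text \<open>The detour through inverses moves the transposition of
  \<open>sum_over_permutations_insert\<close> to the right. The summand for \<open>b = Suc n\<close>
  is \<open>f \<pi>\<close>.\<close>

lemma sum_permutes_Suc:
  fixes f :: "(nat \<Rightarrow> nat) \<Rightarrow> 'a::comm_monoid_add"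
  shows "(\<Sum>\<pi> | \<pi> permutes {1..Suc n}. f \<pi>) =
    (\<Sum>\<pi> | \<pi> permutes {1..n}. f \<pi> + (\<Sum>b=1..n. f (\<pi> \<circ> transpose (Suc n) b)))"
proof -
  let ?S = "{1..n}" and ?N = "Suc n"
  have "(\<Sum>\<pi> | \<pi> permutes {1..?N}. f \<pi>) = (\<Sum>\<pi> | \<pi> permutes insert ?N ?S. f (inv \<pi>))"
    by (subst sum_permutations_inverse) (simp add: atLeastAtMostSuc_conv)
  also have "\<dots> = (\<Sum>b\<in>insert ?N ?S. \<Sum>\<pi> | \<pi> permutes ?S. f (inv (transpose ?N b \<circ> \<pi>)))"
    by (rule sum_over_permutations_insert) auto
  also have "\<dots> = (\<Sum>b\<in>insert ?N ?S. \<Sum>\<pi> | \<pi> permutes ?S. f (inv \<pi> \<circ> transpose ?N b))"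
    by (intro sum.cong refl) (simp add: o_inv_distrib permutes_bij)
  also have "\<dots> = (\<Sum>b\<in>insert ?N ?S. \<Sum>\<pi> | \<pi> permutes ?S. f (\<pi> \<circ> transpose ?N b))"
    by (subst (2) sum_permutations_inverse) simp
  also have "\<dots> = (\<Sum>\<pi> | \<pi> permutes ?S. \<Sum>b\<in>insert ?N ?S. f (\<pi> \<circ> transpose ?N b))"
    by (rule sum.swap)
  finally show ?thesis by simp
qed

text \<open>The factors of the \<open>n + 1\<close> extensions of a fixed \<open>\<pi>\<close> add
  up to the same \<open>qint p q x (Suc n)\<close> for every \<open>\<pi>\<close>.\<close>

lemma sum_weight_Suc:
  "(\<Sum>\<pi> | \<pi> permutes {1..Suc n}. weight p q x (Suc n) \<pi>) =
    (\<Sum>\<pi> | \<pi> permutes {1..n}. weight p q x n \<pi>) * qint p q x (Suc n)"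
proof -
  have "weight p q x (Suc n) \<pi> + (\<Sum>b=1..n. weight p q x (Suc n) (\<pi> \<circ> transpose (Suc n) b)) =
      weight p q x n \<pi> * qint p q x (Suc n)" if \<pi>: "\<pi> permutes {1..n}" for \<pi>
  proof -
    \<comment> \<open>Each letter occurs once in the word, so the sum over letters \<open>b\<close>
      becomes a sum over positions \<open>k\<close>, in which the factor is explicit.\<close>
    have "bij_betw ((!) (Psi n \<pi>)) {..<n} {1..n}"
      using bij_betw_nth[OF distinct_Psi[OF \<pi>], of "{..<n}" "{1..n}"] \<pi>
      by (simp add: length_Psi set_Psi)
    then have "(\<Sum>b=1..n. weight p q x (Suc n) (\<pi> \<circ> transpose (Suc n) b)) =
        (\<Sum>k<n. weight p q x (Suc n) (\<pi> \<circ> transpose (Suc n) (Psi n \<pi> ! k)))"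
      by (rule sum.reindex_bij_betw[symmetric])
    also have "\<dots> = weight p q x n \<pi> * (\<Sum>k<n. p ^ Suc k * q ^ (n - Suc k))"
      using \<pi> by (simp add: weight_insert sum_distrib_left)
    \<comment> \<open>The substitution is \<open>j = n - Suc k\<close>.\<close>
    also have "(\<Sum>k<n. p ^ Suc k * q ^ (n - Suc k)) = (\<Sum>j<n. p ^ (n - j) * q ^ j)"
      by (subst sum.nat_diff_reindex[symmetric])
        (intro sum.cong refl, simp add: Suc_diff_Suc del: power_Suc)
    finally have "(\<Sum>b=1..n. weight p q x (Suc n) (\<pi> \<circ> transpose (Suc n) b)) =
        weight p q x n \<pi> * (\<Sum>j<n. p ^ (n - j) * q ^ j)" .
    then show ?thesis
      by (simp only: weight_fixed_point[OF \<pi>] qint_def diff_Suc_1 distrib_left add.commute)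
  qed
  then show ?thesis
    unfolding sum_permutes_Suc sum_distrib_right by (intro sum.cong refl) simp
qed

text \<open>The induction starts at \<open>n = 0\<close>, where the identity alone contributes 1,
  although \<open>gen_fun\<close> has constant term 0.\<close>

lemma sum_weight: "(\<Sum>\<pi> | \<pi> permutes {1..n}. weight p q x n \<pi>) = (\<Prod>i=1..n. qint p q x i)"
proof (induction n)
  case 0
  then show ?case
    by (simp add: weight_def cyc_non_def cyc_inv_def cyc_def cycle_sets_def numeral_2_eq_2)
next
  case (Suc n)
  then show ?case by (simp only: sum_weight_Suc prod.cl_ivl_Suc) simp
qed

section \<open>The continued fraction\<close>

text \<open>This polynomial is the inverse of \<open>1 - cf_tail a h d\<close>; \<open>d\<close>
  bounds the degree here and counts levels there.\<close>

definition prod_fps :: "(nat \<Rightarrow> 'a::comm_ring_1) \<Rightarrow> nat \<Rightarrow> nat \<Rightarrow> 'a fps" where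
  "prod_fps a h d = Abs_fps (\<lambda>n. if n \<le> d then \<Prod>i=h..<h + n. a i else 0)"

lemma prod_fps_0: "prod_fps a h 0 = 1"
  by (rule fps_ext) (simp add: prod_fps_def)

lemma prod_fps_Suc:
  "prod_fps a h (Suc d) = 1 + fps_const (a h) * fps_X * prod_fps a (Suc h) d"
proof (rule fps_ext)
  fix n
  show "fps_nth (prod_fps a h (Suc d)) n =
    fps_nth (1 + fps_const (a h) * fps_X * prod_fps a (Suc h) d) n"
    by (cases n) (auto simp: prod_fps_def mult.assoc prod.atLeast_Suc_lessThan)
qed

text \<open>The recursion of the tails, cleared of denominators, matches
  \<open>prod_fps_Suc\<close>; a product equal to 1 makes sense in any commutative ring.\<close>

lemma one_minus_cf_tail_mult: "(1 - cf_tail a h d) * prod_fps a h d = 1"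
proof (induction d arbitrary: h)
  case 0
  then show ?case by (simp add: prod_fps_0)
next
  case (Suc d)
  let ?T = "cf_tail a h (Suc d)" and ?T' = "cf_tail a (Suc h) d"
    and ?P = "prod_fps a (Suc h) d" and ?z = "fps_const (a h) * fps_X"
  have T: "?T * (1 + ?z - ?T') = ?z"
    by (simp add: fps_quot1_mult)
  \<comment> \<open>The induction hypothesis \<open>(1 - ?T') * ?P = 1\<close> replaces the summand
    1 in \<open>prod_fps_Suc\<close>.\<close>
  have "prod_fps a h (Suc d) = (1 + ?z - ?T') * ?P"
    using Suc[of "Suc h"] by (simp add: prod_fps_Suc algebra_simps)
  then have "(1 - ?T) * prod_fps a h (Suc d) = (1 + ?z - ?T' - ?T * (1 + ?z - ?T')) * ?P"
    by (simp only: left_diff_distrib mult.assoc mult_1_left)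
  also have "\<dots> = 1"
    unfolding T using Suc[of "Suc h"] by simp
  finally show ?case .
qed

lemma cf_trunc_eq: "cf_trunc a d = fps_const (a 1) * fps_X * prod_fps a 2 d"
proof -
  let ?B = "1 - cf_tail a 2 d"
  have "cf_trunc a d = cf_trunc a d * ?B * prod_fps a 2 d"
    by (simp add: one_minus_cf_tail_mult mult.assoc)
  also have "cf_trunc a d * ?B = fps_const (a 1) * fps_X"
    unfolding cf_trunc_def by (rule fps_quot1_mult) simp
  finally show ?thesis .
qed

text \<open>The factor \<open>a 1\<close> times \<open>fps_X\<close> raises degrees by one, so depth
  \<open>d\<close> settles the coefficients up to \<open>Suc d\<close>.\<close>

lemma cf_trunc_nth:
  assumes "n \<le> Suc d"
  shows "fps_nth (cf_trunc a d) n = (if n = 0 then 0 else \<Prod>i=1..n. a i)"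
proof (cases n)
  case (Suc m)
  have "{2..<2 + m} = {Suc 1..n}" by (auto simp: Suc)
  moreover have "(\<Prod>i=1..n. a i) = a 1 * (\<Prod>i=Suc 1..n. a i)"
    by (rule prod.atLeast_Suc_atMost) (simp add: Suc)
  ultimately have "(\<Prod>i=1..n. a i) = a 1 * (\<Prod>i=2..<2 + m. a i)"
    by simp
  then show ?thesis
    using assms by (simp add: cf_trunc_eq Suc prod_fps_def mult.assoc)
qed (simp add: cf_trunc_eq mult.assoc)

text \<open>Convergence of power series follows once each coefficient is eventually constant; the
  coefficient at \<open>n\<close> is so from depth \<open>n\<close> on.\<close>

lemma cf_trunc_tendsto:
  "cf_trunc a \<longlonglongrightarrow> Abs_fps (\<lambda>n. if n = 0 then 0 else \<Prod>i=1..n. a i)"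
proof (rule tendsto_fpsI)
  fix n
  show "\<forall>\<^sub>F d in sequentially. fps_nth (cf_trunc a d) n =
      fps_nth (Abs_fps (\<lambda>n. if n = 0 then 0 else \<Prod>i=1..n. a i)) n"
    using eventually_ge_at_top[of n]
    by eventually_elim (simp add: cf_trunc_nth)
qed

theorem mainTheorem1:
  fixes p q x :: "'a::comm_ring_1"
  shows "gen_fun p q x = Abs_fps (\<lambda>n. if n = 0 then 0 else \<Prod>i=1..n. qint p q x i)
    \<and> cf_trunc (qint p q x) \<longlonglongrightarrow> gen_fun p q x"
proof -
  have "gen_fun p q x = Abs_fps (\<lambda>n. if n = 0 then 0 else \<Prod>i=1..n. qint p q x i)"
    unfolding gen_fun_def by (simp only: weight_def[symmetric] sum_weight)
  then show ?thesis
    using cf_trunc_tendsto[of "qint p q x"] by simp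
qed

end
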